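(* Let $K_1>1>K_2>0$, $a_2>a_1>0$, $c>0$, $m,n\in\mathbb{N}_0$, and define $$T=\frac{a_1(1+K_1+K_2)+(a_2-a_1)K_2}{1+(m+1)K_2+n(1+K_1+K_2)},\qquad \theta=\frac{a_2-a_1}{T}-m .$$ If the parameters are such that $$\theta\in\left(\frac{K_2}{K_1+K_2-1},\,1\right),$$ then the delay differential equation $$\epsilon\dot u(t)=-u(t)-K_1u(t-a_1-cu(t))-K_2u(t-a_2-cu(t))$$ has a periodic singular solution of period $T>0$ whose profile is the sawtooth profile with parameters $(n,T)$, i.e. $\Gamma(\mu)=(t(\mu),u(\mu))$, $\mu\in\mathbb{R}$, where for each $i\in\mathbb{Z}$ $$t(\mu)=(\mu-i)T,\quad u(\mu)=\frac{-a_1+(n+\mu-2i)T}{c}\quad\text{for }\mu\in[2i,2i+1],$$ $$t(\mu)=(i+1)T,\quad u(\mu)=\frac{-a_1+(n+1-(\mu-2i-1))T}{c}\quad\text{for }\mu\in(2i+1,2i+2).$$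
   Context: $\mathbb{N}_0=\{0,1,2,\dots\}$. Admissible singular solution profile: a continuous injective parametric curve $\Gamma:I\to\mathbb{R}^2$, $\Gamma(\mu)=(t(\mu),u(\mu))$, on a nonempty interval $I\subseteq\mathbb{R}$, with $t$ monotonically increasing (not necessarily strictly). The interval $I$ is partitioned as $I=I^+\cup I^-\cup I^*$, where $I^*$ is a disjoint union of open intervals on each of which $t$ is strictly increasing, and $I^{\pm}$ are disjoint unions of closed intervals on each of which $t$ is constant, with $u$ strictly decreasing on each interval of $I^-$ and strictly increasing on each interval of $I^+$. Singular solution of the equation $\epsilon\dot u(t)=-u(t)-K_1u(t-a_1-cu(t))-K_2u(t-a_2-cu(t))$ (this is an $\epsilon=0$ notion): let $\Gamma$ be an admissible singular solution profile on $I$, let $J\subseteq\mathbb{R}$ be a nonempty interval, and let $\mu_0,\mu_1,\mu_2:J\to I$ be continuous with $\mu_0$ monotonically increasing. Set $J^*=\mathrm{cl}\{\eta:\mu_0(\eta)\in I^*\}$, $J^\pm=\mathrm{int}\{\eta:\mu_0(\eta)\in I^\pm\}$ and $$F(\eta)=-u(\mu_0(\eta))-K_1u(\mu_1(\eta))-K_2u(\mu_2(\eta)).$$ Then $\{\Gamma,\mu_0,\mu_1,\mu_2\}$ is a singular solution on $t(\mu_0(J))$ if $t(\mu_i(\eta))=t(\mu_0(\eta))-a_i-cu(\mu_0(\eta))$ for all $\eta\in J$ and $i=1,2$, and $F(\eta)=0$ for all $\eta\in J^*$, $F(\eta)<0$ for all $\eta\in J^-$, $F(\eta)>0$ for all $\eta\in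 J^+$. The singular solution is periodic if $J=\mathbb{R}$ and there exist $T>0$ and $\eta_T>0$ with $t(\mu_i(\eta+\eta_T))=t(\mu_i(\eta))+T$ and $u(\mu_i(\eta+\eta_T))=u(\mu_i(\eta))$ for all $i=0,1,2$ and all $\eta\in\mathbb{R}$; the period is the smallest such $T>0$. *)

theory Defs
  imports "HOL-Analysis.Analysis" "HOL-Library.Disjoint_Sets"
begin

text \<open>
  A curve is given by a map \<open>\<Gamma> = (t, u)\<close> on the parameter interval \<open>I\<close>, so that
  \<open>t = fst \<circ> \<Gamma>\<close> and \<open>u = snd \<circ> \<Gamma>\<close>. Intervals are nonempty, because \<open>partition_on\<close>
  excludes the empty set as a part.
\<close>

definition union_of_open_intervals :: "(real set \<Rightarrow> bool) \<Rightarrow> real set \<Rightarrow> bool" where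
  "union_of_open_intervals P A \<longleftrightarrow>
     (\<exists>\<A>. partition_on A \<A> \<and> (\<forall>S\<in>\<A>. is_interval S \<and> open S \<and> P S))"

text \<open>
  Closed intervals have to be nondegenerate: every set is a disjoint union of singletons, and
  every function is constant and strictly monotone on a singleton.
\<close>

definition union_of_closed_intervals :: "(real set \<Rightarrow> bool) \<Rightarrow> real set \<Rightarrow> bool" where
  "union_of_closed_intervals P A \<longleftrightarrow>
     (\<exists>\<A>. partition_on A \<A> \<and>
          (\<forall>S\<in>\<A>. is_interval S \<and> closed S \<and> (\<exists>x\<in>S. \<exists>y\<in>S. x < y) \<and> P S))"

definition admissible_profile ::
  "real set \<Rightarrow> (real \<Rightarrow> real \<times> real) \<Rightarrow> real set \<Rightarrow> real set \<Rightarrow> real set \<Rightarrow> bool" where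
  "admissible_profile I \<Gamma> Iplus Iminus Istar \<longleftrightarrow>
     is_interval I \<and> I \<noteq> {} \<and>
     continuous_on I \<Gamma> \<and> inj_on \<Gamma> I \<and> mono_on I (fst \<circ> \<Gamma>) \<and>
     I = Iplus \<union> Iminus \<union> Istar \<and>
     disjnt Iplus Iminus \<and> disjnt Iplus Istar \<and> disjnt Iminus Istar \<and>
     union_of_open_intervals (\<lambda>S. strict_mono_on S (fst \<circ> \<Gamma>)) Istar \<and>
     union_of_closed_intervals
       (\<lambda>S. (fst \<circ> \<Gamma>) constant_on S \<and> strict_antimono_on S (snd \<circ> \<Gamma>)) Iminus \<and>
     union_of_closed_intervals
       (\<lambda>S. (fst \<circ> \<Gamma>) constant_on S \<and> strict_mono_on S (snd \<circ> \<Gamma>)) Iplus"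

text \<open>
  The closure defining \<open>J\<^sup>*\<close> is intersected with \<open>J\<close>, since the maps \<open>\<mu>\<^sub>i\<close> only have a meaning
  there.
\<close>

definition singular_solution ::
  "real \<Rightarrow> real \<Rightarrow> real \<Rightarrow> real \<Rightarrow> real \<Rightarrow> real set \<Rightarrow> (real \<Rightarrow> real \<times> real) \<Rightarrow>
   real set \<Rightarrow> (real \<Rightarrow> real) \<Rightarrow> (real \<Rightarrow> real) \<Rightarrow> (real \<Rightarrow> real) \<Rightarrow> bool" where
  "singular_solution K1 K2 a1 a2 c I \<Gamma> J \<mu>0 \<mu>1 \<mu>2 \<longleftrightarrow>
     (\<exists>Iplus Iminus Istar. admissible_profile I \<Gamma> Iplus Iminus Istar \<and>
       is_interval J \<and> J \<noteq> {} \<and>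
       (\<forall>\<mu>\<in>{\<mu>0, \<mu>1, \<mu>2}. continuous_on J \<mu> \<and> \<mu> ` J \<subseteq> I) \<and>
       mono_on J \<mu>0 \<and>
       (let t = fst \<circ> \<Gamma>; u = snd \<circ> \<Gamma>;
            Jstar = J \<inter> closure {\<eta>\<in>J. \<mu>0 \<eta> \<in> Istar};
            Jplus = interior {\<eta>\<in>J. \<mu>0 \<eta> \<in> Iplus};
            Jminus = interior {\<eta>\<in>J. \<mu>0 \<eta> \<in> Iminus};
            F = (\<lambda>\<eta>. - u (\<mu>0 \<eta>) - K1 * u (\<mu>1 \<eta>) - K2 * u (\<mu>2 \<eta>))
        in (\<forall>\<eta>\<in>J. t (\<mu>1 \<eta>) = t (\<mu>0 \<eta>) - a1 - c * u (\<mu>0 \<eta>) \<and>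
                  t (\<mu>2 \<eta>) = t (\<mu>0 \<eta>) - a2 - c * u (\<mu>0 \<eta>)) \<and>
           (\<forall>\<eta>\<in>Jstar. F \<eta> = 0) \<and> (\<forall>\<eta>\<in>Jminus. F \<eta> < 0) \<and> (\<forall>\<eta>\<in>Jplus. F \<eta> > 0)))"

definition shift_periodic ::
  "(real \<Rightarrow> real \<times> real) \<Rightarrow> (real \<Rightarrow> real) \<Rightarrow> (real \<Rightarrow> real) \<Rightarrow> (real \<Rightarrow> real) \<Rightarrow> real \<Rightarrow> bool" where
  "shift_periodic \<Gamma> \<mu>0 \<mu>1 \<mu>2 T \<longleftrightarrow> T > 0 \<and>
     (\<exists>\<eta>\<^sub>T>0. \<forall>\<mu>\<in>{\<mu>0, \<mu>1, \<mu>2}. \<forall>\<eta>.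
        fst (\<Gamma> (\<mu> (\<eta> + \<eta>\<^sub>T))) = fst (\<Gamma> (\<mu> \<eta>)) + T \<and>
        snd (\<Gamma> (\<mu> (\<eta> + \<eta>\<^sub>T))) = snd (\<Gamma> (\<mu> \<eta>)))"

definition periodic_singular_solution ::
  "real \<Rightarrow> real \<Rightarrow> real \<Rightarrow> real \<Rightarrow> real \<Rightarrow> real set \<Rightarrow> (real \<Rightarrow> real \<times> real) \<Rightarrow>
   (real \<Rightarrow> real) \<Rightarrow> (real \<Rightarrow> real) \<Rightarrow> (real \<Rightarrow> real) \<Rightarrow> real \<Rightarrow> bool" where
  "periodic_singular_solution K1 K2 a1 a2 c I \<Gamma> \<mu>0 \<mu>1 \<mu>2 T \<longleftrightarrow>
     singular_solution K1 K2 a1 a2 c I \<Gamma> UNIV \<mu>0 \<mu>1 \<mu>2 \<and>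
     shift_periodic \<Gamma> \<mu>0 \<mu>1 \<mu>2 T \<and>
     (\<forall>T'. shift_periodic \<Gamma> \<mu>0 \<mu>1 \<mu>2 T' \<longrightarrow> T \<le> T')"

definition sawtooth :: "real \<Rightarrow> real \<Rightarrow> nat \<Rightarrow> real \<Rightarrow> real \<Rightarrow> real \<times> real" where
  "sawtooth a1 c n T \<mu> =
     (let i = real_of_int \<lfloor>\<mu> / 2\<rfloor>
      in if \<mu> \<le> 2 * i + 1
         then ((\<mu> - i) * T, (- a1 + (real n + \<mu> - 2 * i) * T) / c)
         else ((i + 1) * T, (- a1 + (real n + 1 - (\<mu> - 2 * i - 1)) * T) / c))"

lemma sawtooth_rise:
  fixes i :: int and \<mu> a1 c T :: real
  assumes "\<mu> \<in> {2 * real_of_int i .. 2 * real_of_int i + 1}"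
  shows "sawtooth a1 c n T \<mu> = ((\<mu> - i) * T, (- a1 + (real n + \<mu> - 2 * i) * T) / c)"
proof -
  have "\<lfloor>\<mu> / 2\<rfloor> = i" using assms by (intro floor_unique) auto
  then show ?thesis using assms by (simp add: sawtooth_def Let_def)
qed

lemma sawtooth_fall:
  fixes i :: int and \<mu> a1 c T :: real
  assumes "\<mu> \<in> {2 * real_of_int i + 1 <..< 2 * real_of_int i + 2}"
  shows "sawtooth a1 c n T \<mu> = ((i + 1) * T, (- a1 + (real n + 1 - (\<mu> - 2 * i - 1)) * T) / c)"
proof -
  have "\<lfloor>\<mu> / 2\<rfloor> = i" using assms by (intro floor_unique) auto
  then show ?thesis using assms by (simp add: sawtooth_def Let_def)
qed

end

theory Submission
  imports Defs
begin

text \<open>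
  Measure time in units of \<open>T\<close> and write \<open>\<sigma> = t / T\<close> and \<open>v = (c u + a1) / T - n\<close>. The
  sawtooth then satisfies \<open>\<mu> = 2 \<sigma>(\<mu>) - v(\<mu>)\<close>, where \<open>\<sigma>\<close> is a continuous staircase with
  \<open>\<sigma>(\<mu> + 2) = \<sigma>(\<mu>) + 1\<close>; this makes the curve continuous and injective. With
  \<open>a2 - a1 = (m + \<theta>) T\<close> the two delay conditions become
  \<open>\<sigma>(\<mu>1) = \<sigma>(\<mu>0) - v(\<mu>0) - n\<close> and \<open>\<sigma>(\<mu>2) = \<sigma>(\<mu>1) - m - \<theta>\<close>, and \<open>F\<close> is a positive multiple of
  \<open>C - (v(\<mu>0) + K1 v(\<mu>1) + K2 v(\<mu>2))\<close>, where \<open>C = (1 + K1 + K2) (a1 / T - n)\<close>. The formula that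
  defines \<open>T\<close> says exactly that \<open>C = 1 + K2 (1 - \<theta>)\<close>.

  One period of the solution has five phases (shown here for \<open>v0, v1, v2\<close>, the values of \<open>v\<close> at
  the three points).
  \<^item> \<open>v0\<close> rises from 0 to 1 along the slow segment. There \<open>\<sigma> - v\<close> is constant, so the first delayed
    point stays on a vertical segment, where it falls from \<open>1/K1\<close> to 0 to keep \<open>F = 0\<close>; \<open>v2 = 1 - \<theta>\<close>
    is constant. Ending exactly at \<open>v0 = 1\<close>, \<open>v1 = 0\<close> is what fixes \<open>C\<close>.
  \<^item> \<open>v0\<close> falls from 1 to \<open>1 - \<theta>\<close>, while \<open>v1\<close> and \<open>v2\<close> rise at the same rate, until \<open>v2\<close>
    reaches its maximum. Since \<open>K1 + K2 > 1\<close>, this makes \<open>F\<close> negative.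
  \<^item> \<open>v0\<close> and \<open>v1\<close> wait while \<open>v2\<close> runs down its vertical segment from 1 to 0. At the end \<open>F\<close> has the
    sign of \<open>K2 - \<theta> (K1 + K2 - 1)\<close>; this is the step that needs the lower bound on \<open>\<theta>\<close>.
  \<^item> \<open>v0\<close> falls on to 0, while \<open>v1\<close> rises to 1 and \<open>v2\<close> to \<open>1 - \<theta>\<close>. As
    before, \<open>K1 + K2 > 1\<close> makes \<open>F\<close> decrease.
  \<^item> \<open>v0\<close> waits at 0 and \<open>v1\<close> falls from 1 to \<open>1/K1\<close>, at which moment \<open>F\<close> is again 0.

  The period is minimal because \<open>v\<close> vanishes only at the even integers, where \<open>\<sigma>\<close> is an integer.
\<close>

section \<open>Quasi-periodic extensions\<close>

definition quasi_ext :: "real \<Rightarrow> real \<Rightarrow> (real \<Rightarrow> real) \<Rightarrow> real \<Rightarrow> real" where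
  "quasi_ext p d g x = d * real_of_int \<lfloor>x / p\<rfloor> + g (x - p * real_of_int \<lfloor>x / p\<rfloor>)"

text \<open>
  The endpoint \<open>r = p\<close> is included, so that neighbouring pieces can be compared at their common
  endpoint; the matching condition \<open>g p = g 0 + d\<close> pays for it.
\<close>

lemma quasi_ext_eval:
  fixes k :: int
  assumes "p > 0" "g p = g 0 + d" "0 \<le> r" "r \<le> p"
  shows "quasi_ext p d g (p * real_of_int k + r) = d * real_of_int k + g r"
proof (cases "r = p")
  case True
  have eq: "(p * real_of_int k + r) / p = real_of_int (k + 1)"
    using True assms(1) by (simp add: field_simps)
  have "\<lfloor>(p * real_of_int k + r) / p\<rfloor> = k + 1"
    unfolding eq by (rule floor_of_int)
  then show ?thesis
    using True assms(2) by (simp add: quasi_ext_def algebra_simps)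
next
  case False
  have "\<lfloor>(p * real_of_int k + r) / p\<rfloor> = k"
    using False assms by (intro floor_unique) (auto simp: field_simps)
  then show ?thesis by (simp add: quasi_ext_def)
qed

lemma quasi_period_decompose:
  fixes x p :: real
  assumes "p > 0"
  obtains k :: int and r where "x = p * real_of_int k + r" "0 \<le> r" "r < p"
proof
  let ?k = "\<lfloor>x / p\<rfloor>"
  show "x = p * real_of_int ?k + (x - p * real_of_int ?k)" by simp
  show "0 \<le> x - p * real_of_int ?k" "x - p * real_of_int ?k < p"
    using floor_divide_lower[OF assms, of x] floor_divide_upper[OF assms, of x]
    by (auto simp: algebra_simps)
qed

lemma quasi_ext_shift:
  assumes "p > 0"
  shows "quasi_ext p d g (x + p) = quasi_ext p d g x + d"
proof -
  have eq: "(x + p) / p = x / p + 1" using assms by (simp add: field_simps)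
  have "\<lfloor>(x + p) / p\<rfloor> = \<lfloor>x / p\<rfloor> + 1" unfolding eq by linarith
  then show ?thesis by (simp add: quasi_ext_def algebra_simps)
qed

lemma continuous_on_quasi_ext:
  assumes "p > 0" "g p = g 0 + d" and g: "continuous_on {0..p} g"
  shows "continuous_on UNIV (quasi_ext p d g)"
proof -
  have piece: "continuous_on {p * real_of_int k .. p * real_of_int k + p} (quasi_ext p d g)"
    for k :: int
  proof -
    have "continuous_on {p * real_of_int k .. p * real_of_int k + p}
            (\<lambda>x. d * real_of_int k + g (x - p * real_of_int k))"
      by (intro continuous_intros continuous_on_compose2[OF g]) auto
    moreover have "d * real_of_int k + g (x - p * real_of_int k) = quasi_ext p d g x"
      if "x \<in> {p * real_of_int k .. p * real_of_int k + p}" for x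
      using quasi_ext_eval[of p g d "x - p * real_of_int k" k] assms that by simp
    ultimately show ?thesis by (rule continuous_on_eq)
  qed
  have "isCont (quasi_ext p d g) x" for x
  proof -
    obtain k :: int and r where x: "x = p * real_of_int k + r" "0 \<le> r" "r < p"
      using quasi_period_decompose[OF assms(1)] .
    let ?a = "p * real_of_int k"
    have prev: "p * real_of_int (k - 1) = ?a - p" by (simp add: algebra_simps)
    have "continuous_on ({?a - p .. ?a} \<union> {?a .. ?a + p}) (quasi_ext p d g)"
      using piece[of "k - 1"] piece[of k] unfolding prev
      by (intro continuous_on_closed_Un) auto
    then have "continuous_on {?a - p <..< ?a + p} (quasi_ext p d g)"
      by (rule continuous_on_subset) auto
    then show ?thesis
      using x assms(1) by (simp add: continuous_on_eq_continuous_at)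
  qed
  then show ?thesis by (simp add: continuous_on_eq_continuous_at)
qed

lemma mono_on_quasi_ext:
  assumes "p > 0" "g p = g 0 + d" and g: "mono_on {0..p} g"
  shows "mono_on UNIV (quasi_ext p d g)"
proof (rule mono_onI)
  fix x y :: real assume "x \<le> y"
  obtain k :: int and r where x: "x = p * real_of_int k + r" "0 \<le> r" "r < p"
    using quasi_period_decompose[OF assms(1)] .
  obtain l :: int and s where y: "y = p * real_of_int l + s" "0 \<le> s" "s < p"
    using quasi_period_decompose[OF assms(1)] .
  have ext: "quasi_ext p d g x = d * real_of_int k + g r" "quasi_ext p d g y = d * real_of_int l + g s"
    using quasi_ext_eval[of p g d r k] quasi_ext_eval[of p g d s l] assms x y by auto
  have g_le: "g a \<le> g b" if "0 \<le> a" "a \<le> b" "b \<le> p" for a b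
    using mono_onD[OF g, of a b] that by auto
  have d: "0 \<le> d" using g_le[of 0 p] assms by simp
  have "p * real_of_int k < p * (real_of_int l + 1)"
    using \<open>x \<le> y\<close> x y by (simp add: algebra_simps)
  then have "k \<le> l" using assms(1) by (simp add: mult_less_cancel_left_pos)
  show "quasi_ext p d g x \<le> quasi_ext p d g y"
  proof (cases "k = l")
    case True
    then show ?thesis using ext g_le[of r s] \<open>x \<le> y\<close> x y by simp
  next
    case False
    then have "real_of_int k + 1 \<le> real_of_int l" using \<open>k \<le> l\<close> by linarith
    then have "d * (real_of_int k + 1) \<le> d * real_of_int l" using d by (intro mult_left_mono)
    moreover have "g r \<le> g 0 + d" "g 0 \<le> g s"
      using g_le[of r p] g_le[of 0 s] x y assms by auto
    ultimately show ?thesis using ext by (simp add: algebra_simps)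
  qed
qed

section \<open>The sawtooth profile\<close>

text \<open>
  This is \<open>t / T\<close> as a function of the curve parameter: it moves on \<open>[2k, 2k + 1]\<close> and
  rests on \<open>[2k + 1, 2k + 2]\<close>.
\<close>

definition staircase :: "real \<Rightarrow> real" where
  "staircase = quasi_ext 2 1 (min 1)"

lemma staircase_rise:
  fixes k :: int
  assumes "2 * real_of_int k \<le> x" "x \<le> 2 * real_of_int k + 1"
  shows "staircase x = x - real_of_int k"
  using quasi_ext_eval[of 2 "min 1" 1 "x - 2 * real_of_int k" k] assms
  by (simp add: staircase_def)

lemma staircase_flat:
  fixes k :: int
  assumes "2 * real_of_int k + 1 \<le> x" "x \<le> 2 * real_of_int k + 2"
  shows "staircase x = real_of_int k + 1"
  using quasi_ext_eval[of 2 "min 1" 1 "x - 2 * real_of_int k" k] assms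
  by (simp add: staircase_def)

lemma staircase_shift: "staircase (x + 2) = staircase x + 1"
  by (simp add: staircase_def quasi_ext_shift)

lemma continuous_on_staircase: "continuous_on UNIV staircase"
  unfolding staircase_def by (rule continuous_on_quasi_ext) (auto intro!: continuous_intros)

lemma mono_on_staircase: "mono_on UNIV staircase"
  unfolding staircase_def by (rule mono_on_quasi_ext) (auto intro!: mono_onI)

text \<open>The height \<open>v\<close> above the lowest point, in units of \<open>T / c\<close>.\<close>

definition height :: "real \<Rightarrow> real" where
  "height x = 2 * staircase x - x"

lemma continuous_on_height: "continuous_on UNIV height"
  unfolding height_def by (intro continuous_intros continuous_on_staircase)

lemma height_shift: "height (x + 2) = height x"
  by (simp add: height_def staircase_shift)

lemma height_eq_0_imp:
  assumes "height x = 0"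
  obtains k :: int where "staircase x = real_of_int k"
proof -
  obtain k :: int and r where x: "x = 2 * real_of_int k + r" "0 \<le> r" "r < 2"
    using quasi_period_decompose[of 2 x] by auto
  show ?thesis
  proof (cases "r \<le> 1")
    case True
    then have "staircase x = x - real_of_int k" using x by (intro staircase_rise) auto
    then show ?thesis using that[of k] assms x by (simp add: height_def)
  next
    case False
    then have "staircase x = real_of_int k + 1" using x by (intro staircase_flat) auto
    then show ?thesis using assms x by (simp add: height_def)
  qed
qed

text \<open>
  Since \<open>x = 2 * staircase x - height x\<close>, the point on the curve determines the parameter, and
  continuity of the curve reduces to that of the staircase.
\<close>

lemma sawtooth_eq:
  "sawtooth a1 c n T x = (T * staircase x, (- a1 + (real n + height x) * T) / c)"
proof -
  obtain k :: int and r where x: "x = 2 * real_of_int k + r" "0 \<le> r" "r < 2"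
    using quasi_period_decompose[of 2 x] by auto
  show ?thesis
  proof (cases "r \<le> 1")
    case True
    then have "staircase x = x - real_of_int k" using x by (intro staircase_rise) auto
    moreover have "sawtooth a1 c n T x
        = ((x - k) * T, (- a1 + (real n + x - 2 * k) * T) / c)"
      using True x by (intro sawtooth_rise) auto
    ultimately show ?thesis
      unfolding height_def by (simp only:) (simp add: algebra_simps)
  next
    case False
    then have "staircase x = real_of_int k + 1" using x by (intro staircase_flat) auto
    moreover have "sawtooth a1 c n T x
        = ((k + 1) * T, (- a1 + (real n + 1 - (x - 2 * k - 1)) * T) / c)"
      using False x by (intro sawtooth_fall) auto
    ultimately show ?thesis
      unfolding height_def by (simp only:) (simp add: algebra_simps)
  qed
qed

definition rising_part :: "real set" where
  "rising_part = (\<Union>k::int. {2 * real_of_int k <..< 2 * real_of_int k + 1})"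

lemma falling_part_eq:
  "- rising_part = (\<Union>k::int. {2 * real_of_int k + 1 .. 2 * real_of_int k + 2})"
proof (intro set_eqI iffI)
  fix x :: real assume x: "x \<in> - rising_part"
  obtain k :: int and r where r: "x = 2 * real_of_int k + r" "0 \<le> r" "r < 2"
    using quasi_period_decompose[of 2 x] by auto
  show "x \<in> (\<Union>k::int. {2 * real_of_int k + 1 .. 2 * real_of_int k + 2})"
  proof (cases "r = 0")
    case True
    \<comment> \<open>an even integer is the lower end of the fall that belongs to the previous index\<close>
    then have "x \<in> {2 * real_of_int (k - 1) + 1 .. 2 * real_of_int (k - 1) + 2}" using r by simp
    then show ?thesis by blast
  next
    case False
    moreover have "x \<notin> {2 * real_of_int k <..< 2 * real_of_int k + 1}"
      using x unfolding rising_part_def by blast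
    ultimately have "x \<in> {2 * real_of_int k + 1 .. 2 * real_of_int k + 2}" using r by auto
    then show ?thesis by blast
  qed
next
  fix x :: real assume "x \<in> (\<Union>k::int. {2 * real_of_int k + 1 .. 2 * real_of_int k + 2})"
  then obtain k :: int
    where k: "2 * real_of_int k + 1 \<le> x" "x \<le> 2 * real_of_int k + 2" by auto
  show "x \<in> - rising_part"
  proof
    assume "x \<in> rising_part"
    then obtain j :: int where "2 * real_of_int j < x" "x < 2 * real_of_int j + 1"
      by (auto simp: rising_part_def)
    then have "real_of_int j < real_of_int (k + 1)" "real_of_int k < real_of_int j"
      using k by simp_all
    then show False unfolding of_int_less_iff by simp
  qed
qed

lemma partition_on_unit_intervals:
  fixes S :: "int \<Rightarrow> real set" and b :: real
  assumes "\<And>k. S k \<noteq> {}" and "\<And>k. S k \<subseteq> {2 * real_of_int k + b .. 2 * real_of_int k + b + 1}"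
  shows "partition_on (\<Union>k. S k) (range S)"
proof (rule partition_onI)
  fix A B assume "A \<in> range S" "B \<in> range S" "A \<noteq> B"
  then obtain j k where jk: "A = S j" "B = S k" "j \<noteq> k" by auto
  show "disjnt A B"
    unfolding disjnt_iff
  proof (intro allI notI)
    fix x assume "x \<in> A \<and> x \<in> B"
    then have "x \<in> {2 * real_of_int j + b .. 2 * real_of_int j + b + 1}"
      "x \<in> {2 * real_of_int k + b .. 2 * real_of_int k + b + 1}"
      using assms(2) jk by blast+
    then have "real_of_int j < real_of_int (k + 1)" "real_of_int k < real_of_int (j + 1)"
      by simp_all
    then show False using jk(3) unfolding of_int_less_iff by simp
  qed
qed (use assms(1) in auto)

lemma sawtooth_admissible:
  assumes "T > 0" "c > 0"
  shows "admissible_profile UNIV (sawtooth a1 c n T) {} (- rising_part) rising_part"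
proof -
  let ?t = "fst \<circ> sawtooth a1 c n T" and ?u = "snd \<circ> sawtooth a1 c n T"
  have t: "?t = (\<lambda>x. T * staircase x)" by (simp add: fun_eq_iff sawtooth_eq)
  have u: "?u = (\<lambda>x. (- a1 + (real n + height x) * T) / c)"
    by (simp add: fun_eq_iff sawtooth_eq)
  have cont: "continuous_on UNIV (sawtooth a1 c n T)"
    unfolding sawtooth_eq[abs_def]
    by (intro continuous_intros continuous_on_staircase continuous_on_height) (use assms in auto)
  have inj: "inj (sawtooth a1 c n T)"
  proof (rule injI)
    fix x y assume "sawtooth a1 c n T x = sawtooth a1 c n T y"
    then have "staircase x = staircase y" "height x = height y"
      using assms by (auto simp: sawtooth_eq)
    then show "x = y" by (simp add: height_def)
  qed
  have mono: "mono_on UNIV ?t"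
    unfolding t using mono_on_staircase assms by (simp add: monotone_on_def)
  have rising: "union_of_open_intervals (\<lambda>S. strict_mono_on S ?t) rising_part"
    unfolding union_of_open_intervals_def
  proof (intro exI conjI ballI)
    let ?S = "\<lambda>k::int. {2 * real_of_int k <..< 2 * real_of_int k + 1}"
    show "partition_on rising_part (range ?S)"
      unfolding rising_part_def by (rule partition_on_unit_intervals[where b = 0]) auto
    fix S assume "S \<in> range ?S"
    then obtain k :: int where S: "S = ?S k" by auto
    show "is_interval S" "open S" unfolding S by (auto simp: is_interval_oo)
    show "strict_mono_on S ?t"
      unfolding S t using assms
      by (auto simp: staircase_rise[where k = k] intro!: strict_mono_onI)
  qed
  have falling: "union_of_closed_intervals
      (\<lambda>S. ?t constant_on S \<and> strict_antimono_on S ?u) (- rising_part)"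
    unfolding union_of_closed_intervals_def
  proof (intro exI conjI ballI)
    let ?S = "\<lambda>k::int. {2 * real_of_int k + 1 .. 2 * real_of_int k + 2}"
    show "partition_on (- rising_part) (range ?S)"
      unfolding falling_part_eq by (rule partition_on_unit_intervals[where b = 1]) auto
    fix S assume "S \<in> range ?S"
    then obtain k :: int where S: "S = ?S k" by auto
    show "is_interval S" "closed S" unfolding S by (auto simp: is_interval_cc)
    show "\<exists>x\<in>S. \<exists>y\<in>S. x < y"
      unfolding S by (intro bexI[of _ "2 * real_of_int k + 1"] bexI[of _ "2 * real_of_int k + 2"]) auto
    show "?t constant_on S"
      unfolding S constant_on_def t
      by (intro exI[of _ "T * (real_of_int k + 1)"]) (auto simp: staircase_flat[where k = k])
    show "strict_antimono_on S ?u"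
      unfolding S u using assms
      by (auto simp: height_def staircase_flat[where k = k] monotone_on_def
          intro!: divide_strict_right_mono)
  qed
  have empty: "union_of_closed_intervals P {}" for P
    unfolding union_of_closed_intervals_def by (intro exI[of _ "{}"]) (simp add: partition_on_empty)
  show ?thesis
    unfolding admissible_profile_def
    using cont inj mono rising falling empty by (auto simp: disjnt_def)
qed

section \<open>The five phases\<close>

definition ramp :: "real \<Rightarrow> real \<Rightarrow> real \<Rightarrow> real" where
  "ramp a b r = max 0 (min (b - a) (r - a))"

lemma continuous_on_ramp [continuous_intros]: "continuous_on A (ramp a b)"
  unfolding ramp_def by (intro continuous_intros)

text \<open>
  The formulas for \<open>T\<close> and \<open>\<theta>\<close> act through the last two assumptions: the delays differ by
  \<open>m + \<theta>\<close> periods, and the right-hand side vanishes when \<open>v0 = 1\<close>, \<open>v1 = 0\<close>, \<open>v2 = 1 - \<theta>\<close>.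
\<close>

locale sawtooth_parameters =
  fixes K1 K2 a1 a2 c T \<theta> :: real and m n :: nat
  assumes K1: "K1 > 1" and K2: "K2 > 0" and c: "c > 0" and T: "T > 0"
    and \<theta>: "0 < \<theta>" "\<theta> < 1" and \<theta>_lower: "K2 < \<theta> * (K1 + K2 - 1)"
    and delay_diff: "a2 - a1 = (real m + \<theta>) * T"
    and balance: "(1 + K1 + K2) * (a1 - real n * T) = T * (1 + K2 * (1 - \<theta>))"
begin

text \<open>
  The five phases occupy \<open>[0, 1]\<close>, \<open>[1, 1 + \<theta>]\<close>, \<open>[1 + \<theta>, 2 + \<theta>]\<close>, \<open>[2 + \<theta>, 3]\<close> and \<open>[3, 4]\<close>.
  Each of the three points advances by 2, one tooth, in each period of length 4. The delayed points
  trail the current one by \<open>n\<close> and by about \<open>n + m\<close> teeth. While \<open>v0\<close> rises by 1, \<open>v1\<close> may only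
  fall by \<open>1/K1\<close>, which is why \<open>\<mu>1\<close> has slope \<open>1/K1\<close> on the first phase and makes up for it on
  the last.
\<close>

definition \<mu>0 :: "real \<Rightarrow> real" where
  "\<mu>0 = quasi_ext 4 2 (\<lambda>r. ramp 0 (1 + \<theta>) r + ramp (2 + \<theta>) 3 r)"

definition \<mu>1 :: "real \<Rightarrow> real" where
  "\<mu>1 = quasi_ext 4 2 (\<lambda>r. - 2 * real n - (1 - ramp 0 1 r) / K1
     + ramp 1 (1 + \<theta>) r + ramp (2 + \<theta>) 3 r + (1 - 1 / K1) * ramp 3 4 r)"

definition \<mu>2 :: "real \<Rightarrow> real" where
  "\<mu>2 = quasi_ext 4 2 (\<lambda>r. - 2 * real n - 2 * real m - 1 - \<theta> + ramp 1 3 r)"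

lemma \<mu>0_eval:
  assumes "0 \<le> r" "r \<le> 4"
  shows "\<mu>0 (4 * real_of_int k + r)
    = 2 * real_of_int k + ramp 0 (1 + \<theta>) r + ramp (2 + \<theta>) 3 r"
  unfolding \<mu>0_def using assms \<theta> by (subst quasi_ext_eval) (auto simp: ramp_def)

lemma \<mu>1_eval:
  assumes "0 \<le> r" "r \<le> 4"
  shows "\<mu>1 (4 * real_of_int k + r) = 2 * real_of_int (k - int n) - (1 - ramp 0 1 r) / K1
     + ramp 1 (1 + \<theta>) r + ramp (2 + \<theta>) 3 r + (1 - 1 / K1) * ramp 3 4 r"
  unfolding \<mu>1_def using assms \<theta> by (subst quasi_ext_eval) (auto simp: ramp_def)

lemma \<mu>2_eval:
  assumes "0 \<le> r" "r \<le> 4"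
  shows "\<mu>2 (4 * real_of_int k + r)
    = 2 * real_of_int (k - int n - int m) - 1 - \<theta> + ramp 1 3 r"
  unfolding \<mu>2_def using assms by (subst quasi_ext_eval) (auto simp: ramp_def)

lemma \<mu>_shift: "\<mu>0 (\<eta> + 4) = \<mu>0 \<eta> + 2" "\<mu>1 (\<eta> + 4) = \<mu>1 \<eta> + 2" "\<mu>2 (\<eta> + 4) = \<mu>2 \<eta> + 2"
  unfolding \<mu>0_def \<mu>1_def \<mu>2_def by (simp_all add: quasi_ext_shift)

lemma continuous_on_\<mu>: "continuous_on UNIV \<mu>0" "continuous_on UNIV \<mu>1" "continuous_on UNIV \<mu>2"
  unfolding \<mu>0_def \<mu>1_def \<mu>2_def using \<theta> K1
  by (auto intro!: continuous_on_quasi_ext continuous_intros simp: ramp_def)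

lemma mono_on_\<mu>0: "mono_on UNIV \<mu>0"
  unfolding \<mu>0_def using \<theta>
  by (intro mono_on_quasi_ext) (auto simp: ramp_def intro!: mono_onI)

lemma inverse_K1: "0 < 1 / K1" "1 / K1 < 1"
  using K1 by auto

lemma phase_rise:
  fixes k :: int
  assumes r: "0 \<le> r" "r \<le> 1" and \<eta>: "\<eta> = 4 * real_of_int k + r"
  shows "\<mu>0 \<eta> = 2 * real_of_int k + r"
    and "\<mu>1 \<eta> = 2 * real_of_int (k - int n) - (1 - r) / K1"
    and "\<mu>2 \<eta> = 2 * real_of_int (k - int n - int m) - 1 - \<theta>"
    and "staircase (\<mu>0 \<eta>) = real_of_int k + r"
    and "staircase (\<mu>1 \<eta>) = real_of_int (k - int n)"
    and "staircase (\<mu>2 \<eta>) = real_of_int (k - int n - int m) - \<theta>"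
proof -
  show 0: "\<mu>0 \<eta> = 2 * real_of_int k + r"
    using r \<theta> by (simp add: \<eta> \<mu>0_eval ramp_def)
  show 1: "\<mu>1 \<eta> = 2 * real_of_int (k - int n) - (1 - r) / K1"
    using r \<theta> by (simp add: \<eta> \<mu>1_eval ramp_def)
  show 2: "\<mu>2 \<eta> = 2 * real_of_int (k - int n - int m) - 1 - \<theta>"
    using r by (simp add: \<eta> \<mu>2_eval ramp_def)
  have "0 \<le> (1 - r) / K1" "(1 - r) / K1 \<le> 1" using r K1 by (auto simp: field_simps)
  then show "staircase (\<mu>1 \<eta>) = real_of_int (k - int n)"
    unfolding 1 by (subst staircase_flat[where k = "k - int n - 1"]) auto
  show "staircase (\<mu>0 \<eta>) = real_of_int k + r"
    unfolding 0 using r by (subst staircase_rise[where k = k]) auto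
  show "staircase (\<mu>2 \<eta>) = real_of_int (k - int n - int m) - \<theta>"
    unfolding 2 using \<theta> by (subst staircase_rise[where k = "k - int n - int m - 1"]) auto
qed

lemma phase_fall_start:
  fixes k :: int
  assumes r: "1 \<le> r" "r \<le> 1 + \<theta>" and \<eta>: "\<eta> = 4 * real_of_int k + r"
  shows "\<mu>0 \<eta> = 2 * real_of_int k + r"
    and "\<mu>1 \<eta> = 2 * real_of_int (k - int n) + r - 1"
    and "\<mu>2 \<eta> = 2 * real_of_int (k - int n - int m) - 2 - \<theta> + r"
    and "staircase (\<mu>0 \<eta>) = real_of_int k + 1"
    and "staircase (\<mu>1 \<eta>) = real_of_int (k - int n) + r - 1"
    and "staircase (\<mu>2 \<eta>) = real_of_int (k - int n - int m) - 1 - \<theta> + r"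
proof -
  show 0: "\<mu>0 \<eta> = 2 * real_of_int k + r"
    using r \<theta> by (simp add: \<eta> \<mu>0_eval ramp_def)
  show 1: "\<mu>1 \<eta> = 2 * real_of_int (k - int n) + r - 1"
    using r \<theta> by (simp add: \<eta> \<mu>1_eval ramp_def)
  show 2: "\<mu>2 \<eta> = 2 * real_of_int (k - int n - int m) - 2 - \<theta> + r"
    using r \<theta> by (simp add: \<eta> \<mu>2_eval ramp_def)
  show "staircase (\<mu>0 \<eta>) = real_of_int k + 1"
    unfolding 0 using r \<theta> by (subst staircase_flat[where k = k]) auto
  show "staircase (\<mu>1 \<eta>) = real_of_int (k - int n) + r - 1"
    unfolding 1 using r \<theta> by (subst staircase_rise[where k = "k - int n"]) auto
  show "staircase (\<mu>2 \<eta>) = real_of_int (k - int n - int m) - 1 - \<theta> + r"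
    unfolding 2 using r \<theta> by (subst staircase_rise[where k = "k - int n - int m - 1"]) auto
qed

lemma phase_wait_high:
  fixes k :: int
  assumes r: "1 + \<theta> \<le> r" "r \<le> 2 + \<theta>" and \<eta>: "\<eta> = 4 * real_of_int k + r"
  shows "\<mu>0 \<eta> = 2 * real_of_int k + 1 + \<theta>"
    and "\<mu>1 \<eta> = 2 * real_of_int (k - int n) + \<theta>"
    and "\<mu>2 \<eta> = 2 * real_of_int (k - int n - int m) - 2 - \<theta> + r"
    and "staircase (\<mu>0 \<eta>) = real_of_int k + 1"
    and "staircase (\<mu>1 \<eta>) = real_of_int (k - int n) + \<theta>"
    and "staircase (\<mu>2 \<eta>) = real_of_int (k - int n - int m)"
proof -
  show 0: "\<mu>0 \<eta> = 2 * real_of_int k + 1 + \<theta>"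
    using r \<theta> by (simp add: \<eta> \<mu>0_eval ramp_def)
  show 1: "\<mu>1 \<eta> = 2 * real_of_int (k - int n) + \<theta>"
    using r \<theta> by (simp add: \<eta> \<mu>1_eval ramp_def)
  show 2: "\<mu>2 \<eta> = 2 * real_of_int (k - int n - int m) - 2 - \<theta> + r"
    using r \<theta> by (simp add: \<eta> \<mu>2_eval ramp_def)
  show "staircase (\<mu>0 \<eta>) = real_of_int k + 1"
    unfolding 0 using \<theta> by (subst staircase_flat[where k = k]) auto
  show "staircase (\<mu>1 \<eta>) = real_of_int (k - int n) + \<theta>"
    unfolding 1 using \<theta> by (subst staircase_rise[where k = "k - int n"]) auto
  show "staircase (\<mu>2 \<eta>) = real_of_int (k - int n - int m)"
    unfolding 2 using r by (subst staircase_flat[where k = "k - int n - int m - 1"]) auto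
qed

lemma phase_fall_end:
  fixes k :: int
  assumes r: "2 + \<theta> \<le> r" "r \<le> 3" and \<eta>: "\<eta> = 4 * real_of_int k + r"
  shows "\<mu>0 \<eta> = 2 * real_of_int k + r - 1"
    and "\<mu>1 \<eta> = 2 * real_of_int (k - int n) + r - 2"
    and "\<mu>2 \<eta> = 2 * real_of_int (k - int n - int m) - 2 - \<theta> + r"
    and "staircase (\<mu>0 \<eta>) = real_of_int k + 1"
    and "staircase (\<mu>1 \<eta>) = real_of_int (k - int n) + r - 2"
    and "staircase (\<mu>2 \<eta>) = real_of_int (k - int n - int m) - 2 - \<theta> + r"
proof -
  show 0: "\<mu>0 \<eta> = 2 * real_of_int k + r - 1"
    using r \<theta> by (simp add: \<eta> \<mu>0_eval ramp_def)
  show 1: "\<mu>1 \<eta> = 2 * real_of_int (k - int n) + r - 2"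
    using r \<theta> by (simp add: \<eta> \<mu>1_eval ramp_def)
  show 2: "\<mu>2 \<eta> = 2 * real_of_int (k - int n - int m) - 2 - \<theta> + r"
    using r \<theta> by (simp add: \<eta> \<mu>2_eval ramp_def)
  show "staircase (\<mu>0 \<eta>) = real_of_int k + 1"
    unfolding 0 using r \<theta> by (subst staircase_flat[where k = k]) auto
  show "staircase (\<mu>1 \<eta>) = real_of_int (k - int n) + r - 2"
    unfolding 1 using r \<theta> by (subst staircase_rise[where k = "k - int n"]) auto
  show "staircase (\<mu>2 \<eta>) = real_of_int (k - int n - int m) - 2 - \<theta> + r"
    unfolding 2 using r \<theta> by (subst staircase_rise[where k = "k - int n - int m"]) auto
qed

lemma phase_wait_low:
  fixes k :: int
  assumes r: "3 \<le> r" "r \<le> 4" and \<eta>: "\<eta> = 4 * real_of_int k + r"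
  shows "\<mu>0 \<eta> = 2 * real_of_int k + 2"
    and "\<mu>1 \<eta> = 2 * real_of_int (k - int n) + 1 + (1 - 1 / K1) * (r - 3)"
    and "\<mu>2 \<eta> = 2 * real_of_int (k - int n - int m) + 1 - \<theta>"
    and "staircase (\<mu>0 \<eta>) = real_of_int k + 1"
    and "staircase (\<mu>1 \<eta>) = real_of_int (k - int n) + 1"
    and "staircase (\<mu>2 \<eta>) = real_of_int (k - int n - int m) + 1 - \<theta>"
proof -
  show 0: "\<mu>0 \<eta> = 2 * real_of_int k + 2"
    using r \<theta> by (simp add: \<eta> \<mu>0_eval ramp_def)
  show 1: "\<mu>1 \<eta> = 2 * real_of_int (k - int n) + 1 + (1 - 1 / K1) * (r - 3)"
    using r \<theta> by (simp add: \<eta> \<mu>1_eval ramp_def)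
  show 2: "\<mu>2 \<eta> = 2 * real_of_int (k - int n - int m) + 1 - \<theta>"
    using r \<theta> by (simp add: \<eta> \<mu>2_eval ramp_def)
  have "0 \<le> (1 - 1 / K1) * (r - 3)" "(1 - 1 / K1) * (r - 3) \<le> 1"
    using r inverse_K1 by (auto intro: mult_le_one)
  then show "staircase (\<mu>1 \<eta>) = real_of_int (k - int n) + 1"
    unfolding 1 by (subst staircase_flat[where k = "k - int n"]) auto
  show "staircase (\<mu>0 \<eta>) = real_of_int k + 1"
    unfolding 0 by (subst staircase_flat[where k = k]) auto
  show "staircase (\<mu>2 \<eta>) = real_of_int (k - int n - int m) + 1 - \<theta>"
    unfolding 2 using \<theta> by (subst staircase_rise[where k = "k - int n - int m"]) auto
qed

lemma phase_cases:
  fixes \<eta> :: real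
  obtains (rise) k :: int and r where "\<eta> = 4 * real_of_int k + r" "0 \<le> r" "r \<le> 1"
  | (fall_start) k :: int and r where "\<eta> = 4 * real_of_int k + r" "1 < r" "r \<le> 1 + \<theta>"
  | (wait_high) k :: int and r where "\<eta> = 4 * real_of_int k + r" "1 + \<theta> \<le> r" "r \<le> 2 + \<theta>"
  | (fall_end) k :: int and r where "\<eta> = 4 * real_of_int k + r" "2 + \<theta> \<le> r" "r \<le> 3"
  | (wait_low) k :: int and r where "\<eta> = 4 * real_of_int k + r" "3 \<le> r" "r < 4"
proof -
  obtain k :: int and r where r: "\<eta> = 4 * real_of_int k + r" "0 \<le> r" "r < 4"
    using quasi_period_decompose[of 4 \<eta>] by auto
  consider "r \<le> 1" | "1 < r" "r \<le> 1 + \<theta>" | "1 + \<theta> \<le> r" "r \<le> 2 + \<theta>"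
    | "2 + \<theta> \<le> r" "r \<le> 3" | "3 \<le> r" by linarith
  then show ?thesis
    by cases (use r that in blast)+
qed

text \<open>
  Both conditions say that \<open>staircase - height\<close>, which rests while \<open>v0\<close> rises and moves while
  \<open>v0\<close> falls, is the time at the delayed points up to a constant. A waiting phase of \<open>\<mu>0\<close> is
  possible because a delayed point can move along a vertical segment without changing its time.
\<close>

lemma delay_conditions:
  "staircase (\<mu>1 \<eta>) = staircase (\<mu>0 \<eta>) - height (\<mu>0 \<eta>) - real n"
  "staircase (\<mu>2 \<eta>) = staircase (\<mu>0 \<eta>) - height (\<mu>0 \<eta>) - real n - real m - \<theta>"
  unfolding atomize_conj
proof (cases \<eta> rule: phase_cases)
  case (rise k r)
  note phase_rise[OF rise(2,3,1)]
  then show "staircase (\<mu>1 \<eta>) = staircase (\<mu>0 \<eta>) - height (\<mu>0 \<eta>) - real n \<and>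
    staircase (\<mu>2 \<eta>) = staircase (\<mu>0 \<eta>) - height (\<mu>0 \<eta>) - real n - real m - \<theta>"
    by (simp add: height_def)
next
  case (fall_start k r)
  note phase_fall_start[OF less_imp_le[OF fall_start(2)] fall_start(3,1)]
  then show "staircase (\<mu>1 \<eta>) = staircase (\<mu>0 \<eta>) - height (\<mu>0 \<eta>) - real n \<and>
    staircase (\<mu>2 \<eta>) = staircase (\<mu>0 \<eta>) - height (\<mu>0 \<eta>) - real n - real m - \<theta>"
    by (simp add: height_def)
next
  case (wait_high k r)
  note phase_wait_high[OF wait_high(2,3,1)]
  then show "staircase (\<mu>1 \<eta>) = staircase (\<mu>0 \<eta>) - height (\<mu>0 \<eta>) - real n \<and>
    staircase (\<mu>2 \<eta>) = staircase (\<mu>0 \<eta>) - height (\<mu>0 \<eta>) - real n - real m - \<theta>"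
    by (simp add: height_def)
next
  case (fall_end k r)
  note phase_fall_end[OF fall_end(2,3,1)]
  then show "staircase (\<mu>1 \<eta>) = staircase (\<mu>0 \<eta>) - height (\<mu>0 \<eta>) - real n \<and>
    staircase (\<mu>2 \<eta>) = staircase (\<mu>0 \<eta>) - height (\<mu>0 \<eta>) - real n - real m - \<theta>"
    by (simp add: height_def)
next
  case (wait_low k r)
  note phase_wait_low[OF wait_low(2) less_imp_le[OF wait_low(3)] wait_low(1)]
  then show "staircase (\<mu>1 \<eta>) = staircase (\<mu>0 \<eta>) - height (\<mu>0 \<eta>) - real n \<and>
    staircase (\<mu>2 \<eta>) = staircase (\<mu>0 \<eta>) - height (\<mu>0 \<eta>) - real n - real m - \<theta>"
    by (simp add: height_def)
qed

section \<open>The sign of the right-hand side\<close>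

text \<open>
  Up to the factor \<open>- T / c\<close> this is \<open>F\<close>; the subtracted constant is the value of \<open>C\<close> given by the
  balance assumption.
\<close>

definition excess :: "real \<Rightarrow> real" where
  "excess \<eta> = height (\<mu>0 \<eta>) + K1 * height (\<mu>1 \<eta>) + K2 * height (\<mu>2 \<eta>) - (1 + K2 * (1 - \<theta>))"

lemma rhs_eq_excess:
  "- snd (sawtooth a1 c n T (\<mu>0 \<eta>)) - K1 * snd (sawtooth a1 c n T (\<mu>1 \<eta>))
     - K2 * snd (sawtooth a1 c n T (\<mu>2 \<eta>)) = - (T / c) * excess \<eta>"
proof -
  let ?S = "height (\<mu>0 \<eta>) + K1 * height (\<mu>1 \<eta>) + K2 * height (\<mu>2 \<eta>)"
  have "- snd (sawtooth a1 c n T (\<mu>0 \<eta>)) - K1 * snd (sawtooth a1 c n T (\<mu>1 \<eta>))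
      - K2 * snd (sawtooth a1 c n T (\<mu>2 \<eta>))
      = ((1 + K1 + K2) * (a1 - real n * T) - T * ?S) / c"
    using c by (simp add: sawtooth_eq field_simps)
  also have "\<dots> = - (T / c) * excess \<eta>"
    unfolding balance excess_def using c by (simp add: field_simps)
  finally show ?thesis .
qed

lemma continuous_on_excess: "continuous_on UNIV excess"
  unfolding excess_def
  by (intro continuous_intros continuous_on_compose2[OF continuous_on_height] continuous_on_\<mu>) auto

lemma excess_rise:
  assumes "0 \<le> r" "r \<le> 1" "\<eta> = 4 * real_of_int k + r"
  shows "excess \<eta> = 0"
  unfolding excess_def height_def
  unfolding phase_rise(4-6)[OF assms]
  unfolding phase_rise(1-3)[OF assms]
  using K1 by (simp add: field_simps)

lemma excess_pos:
  assumes "1 < r" "r < 4" and \<eta>: "\<eta> = 4 * real_of_int k + r"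
  shows "excess \<eta> > 0"
proof -
  consider "r \<le> 1 + \<theta>" | "1 + \<theta> \<le> r" "r \<le> 2 + \<theta>" | "2 + \<theta> \<le> r" "r \<le> 3" | "3 \<le> r" by linarith
  then show ?thesis
  proof cases
    case 1
    have "excess \<eta> = (r - 1) * (K1 + K2 - 1)"
      unfolding excess_def height_def
      unfolding phase_fall_start(4-6)[OF less_imp_le[OF assms(1)] 1 \<eta>]
      unfolding phase_fall_start(1-3)[OF less_imp_le[OF assms(1)] 1 \<eta>]
      by (simp add: algebra_simps)
    then show ?thesis using assms(1) K1 K2 by simp
  next
    case 2
    have "excess \<eta> = \<theta> * (K1 + K2 - 1) - K2 * (r - 1 - \<theta>)"
      unfolding excess_def height_def
      unfolding phase_wait_high(4-6)[OF 2 \<eta>]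
      unfolding phase_wait_high(1-3)[OF 2 \<eta>]
      by (simp add: algebra_simps)
    moreover have "K2 * (r - 1 - \<theta>) \<le> K2 * 1" using 2 K2 by (intro mult_left_mono) auto
    ultimately show ?thesis using \<theta>_lower by simp
  next
    case 3
    have "excess \<eta> = (r - 2) * (K1 + K2 - 1) - K2"
      unfolding excess_def height_def
      unfolding phase_fall_end(4-6)[OF 3 \<eta>]
      unfolding phase_fall_end(1-3)[OF 3 \<eta>]
      by (simp add: algebra_simps)
    moreover have "\<theta> * (K1 + K2 - 1) \<le> (r - 2) * (K1 + K2 - 1)"
      using 3 K1 K2 by (intro mult_right_mono) auto
    ultimately show ?thesis using \<theta>_lower by simp
  next
    case 4
    have "excess \<eta> = (K1 - 1) * (4 - r)"
      unfolding excess_def height_def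
      unfolding phase_wait_low(4-6)[OF 4 less_imp_le[OF assms(2)] \<eta>]
      unfolding phase_wait_low(1-3)[OF 4 less_imp_le[OF assms(2)] \<eta>]
      using K1 by (simp add: field_simps)
    then show ?thesis using assms(2) K1 by simp
  qed
qed

lemma \<mu>0_rising_iff:
  assumes "0 \<le> r" "r < 4" and \<eta>: "\<eta> = 4 * real_of_int k + r"
  shows "\<mu>0 \<eta> \<in> rising_part \<longleftrightarrow> 0 < r \<and> r < 1"
proof
  assume "0 < r \<and> r < 1"
  then have "\<mu>0 \<eta> \<in> {2 * real_of_int k <..< 2 * real_of_int k + 1}"
    using phase_rise(1)[OF _ _ \<eta>] by auto
  then show "\<mu>0 \<eta> \<in> rising_part" unfolding rising_part_def by blast
next
  assume rising: "\<mu>0 \<eta> \<in> rising_part"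
  show "0 < r \<and> r < 1"
  proof (rule ccontr)
    assume not: "\<not> (0 < r \<and> r < 1)"
    have "\<mu>0 \<eta> \<in> - rising_part"
    proof (cases "r = 0")
      case True
      then have "\<mu>0 \<eta> \<in> {2 * real_of_int (k - 1) + 1 .. 2 * real_of_int (k - 1) + 2}"
        using phase_rise(1)[OF _ _ \<eta>] by simp
      then show ?thesis unfolding falling_part_eq by blast
    next
      case False
      have "\<mu>0 \<eta> = 2 * real_of_int k + ramp 0 (1 + \<theta>) r + ramp (2 + \<theta>) 3 r"
        using \<mu>0_eval[of r k] assms by simp
      then have "\<mu>0 \<eta> \<in> {2 * real_of_int k + 1 .. 2 * real_of_int k + 2}"
        using False not assms(1,2) \<theta> by (auto simp: ramp_def)
      then show ?thesis unfolding falling_part_eq by blast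
    qed
    then show False using rising by simp
  qed
qed

text \<open>By continuity the equation extends from the slow phases to their closure.\<close>

lemma excess_closure_rising:
  assumes "\<eta> \<in> closure {\<eta>. \<mu>0 \<eta> \<in> rising_part}"
  shows "excess \<eta> = 0"
proof -
  have "closed {\<eta>. excess \<eta> = 0}"
    using continuous_on_excess by (intro closed_Collect_eq continuous_on_const)
  moreover have "{\<eta>. \<mu>0 \<eta> \<in> rising_part} \<subseteq> {\<eta>. excess \<eta> = 0}"
  proof
    fix \<eta> assume "\<eta> \<in> {\<eta>. \<mu>0 \<eta> \<in> rising_part}"
    moreover obtain k :: int and r where r: "\<eta> = 4 * real_of_int k + r" "0 \<le> r" "r < 4"
      using quasi_period_decompose[of 4 \<eta>] by auto
    ultimately have "0 < r" "r < 1" using \<mu>0_rising_iff[OF r(2,3,1)] by auto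
    then show "\<eta> \<in> {\<eta>. excess \<eta> = 0}" using excess_rise[OF _ _ r(1)] by simp
  qed
  ultimately show ?thesis using closure_minimal assms by blast
qed

text \<open>
  Taking the interior removes both ends of the fast phase, where the right-hand side is 0:
  they lie in the closure of a slow phase.
\<close>

lemma excess_interior_falling:
  assumes "\<eta> \<in> interior {\<eta>. \<mu>0 \<eta> \<in> - rising_part}"
  shows "excess \<eta> > 0"
proof -
  obtain k :: int and r where r: "\<eta> = 4 * real_of_int k + r" "0 \<le> r" "r < 4"
    using quasi_period_decompose[of 4 \<eta>] by auto
  let ?S = "{4 * real_of_int k <..< 4 * real_of_int k + 1}"
  have "?S \<subseteq> {\<eta>. \<mu>0 \<eta> \<in> rising_part}"
  proof
    fix x assume "x \<in> ?S"
    then show "x \<in> {\<eta>. \<mu>0 \<eta> \<in> rising_part}"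
      using \<mu>0_rising_iff[of "x - 4 * real_of_int k" x k] by simp
  qed
  then have "closure ?S \<subseteq> closure {\<eta>. \<mu>0 \<eta> \<in> rising_part}" by (rule closure_mono)
  moreover have "{\<eta>. \<mu>0 \<eta> \<in> - rising_part} = - {\<eta>. \<mu>0 \<eta> \<in> rising_part}" by auto
  ultimately have "\<eta> \<notin> closure ?S" using assms by (auto simp: interior_complement)
  then have "1 < r" using r by simp
  then show ?thesis using excess_pos r by blast
qed

section \<open>The periodic solution\<close>

lemma singular:
  "singular_solution K1 K2 a1 a2 c UNIV (sawtooth a1 c n T) UNIV \<mu>0 \<mu>1 \<mu>2"
proof -
  let ?\<Gamma> = "sawtooth a1 c n T"
  have delay: "fst (?\<Gamma> (\<mu>1 \<eta>)) = fst (?\<Gamma> (\<mu>0 \<eta>)) - a1 - c * snd (?\<Gamma> (\<mu>0 \<eta>))"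
    "fst (?\<Gamma> (\<mu>2 \<eta>)) = fst (?\<Gamma> (\<mu>0 \<eta>)) - a2 - c * snd (?\<Gamma> (\<mu>0 \<eta>))" for \<eta>
  proof -
    have a2: "a2 = a1 + (real m + \<theta>) * T" using delay_diff by simp
    have cu: "c * snd (?\<Gamma> x) = - a1 + (real n + height x) * T" for x
      using c by (simp add: sawtooth_eq)
    have t: "fst (?\<Gamma> x) = T * staircase x" for x by (simp add: sawtooth_eq)
    show "fst (?\<Gamma> (\<mu>1 \<eta>)) = fst (?\<Gamma> (\<mu>0 \<eta>)) - a1 - c * snd (?\<Gamma> (\<mu>0 \<eta>))"
      unfolding t cu by (simp add: delay_conditions algebra_simps)
    show "fst (?\<Gamma> (\<mu>2 \<eta>)) = fst (?\<Gamma> (\<mu>0 \<eta>)) - a2 - c * snd (?\<Gamma> (\<mu>0 \<eta>))"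
      unfolding t cu by (simp add: delay_conditions a2 algebra_simps)
  qed
  show ?thesis
    unfolding singular_solution_def Let_def
  proof (rule exI[of _ "{}"], rule exI[of _ "- rising_part"], rule exI[of _ rising_part])
  qed (use sawtooth_admissible[OF T c, of a1 n] continuous_on_\<mu> mono_on_\<mu>0 delay T c
      excess_closure_rising excess_interior_falling
    in \<open>simp add: rhs_eq_excess zero_less_mult_iff zero_less_divide_iff\<close>)
qed

lemma shift_periodic_T: "shift_periodic (sawtooth a1 c n T) \<mu>0 \<mu>1 \<mu>2 T"
  unfolding shift_periodic_def
  using T by (intro conjI exI[of _ 4])
    (auto simp: sawtooth_eq \<mu>_shift staircase_shift height_shift distrib_left)

text \<open>
  At parameter 0 the point \<open>\<mu>0\<close> sits at a minimum of the sawtooth. A shift that preserves \<open>u\<close> must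
  lead to another minimum, and the minima are a multiple of \<open>T\<close> apart in time.
\<close>

lemma period_minimal:
  assumes "shift_periodic (sawtooth a1 c n T) \<mu>0 \<mu>1 \<mu>2 T'"
  shows "T \<le> T'"
proof -
  obtain \<eta>T where "T' > 0" and shift:
    "fst (sawtooth a1 c n T (\<mu>0 (0 + \<eta>T))) = fst (sawtooth a1 c n T (\<mu>0 0)) + T'"
    "snd (sawtooth a1 c n T (\<mu>0 (0 + \<eta>T))) = snd (sawtooth a1 c n T (\<mu>0 0))"
    using assms unfolding shift_periodic_def by blast
  have "\<mu>0 0 = 0" "staircase (\<mu>0 0) = 0"
    using phase_rise(1,4)[of 0 0 0] by simp_all
  then have 0: "staircase (\<mu>0 0) = 0" "height (\<mu>0 0) = 0" by (simp_all add: height_def)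
  have "height (\<mu>0 \<eta>T) = 0" using shift(2) T c by (simp add: sawtooth_eq 0)
  then obtain k :: int where "staircase (\<mu>0 \<eta>T) = real_of_int k" by (rule height_eq_0_imp)
  then have k: "T' = T * real_of_int k" using shift(1) by (simp add: sawtooth_eq 0)
  then have "k > 0" using \<open>T' > 0\<close> T by (simp add: zero_less_mult_iff)
  then have "1 \<le> real_of_int k" by linarith
  then have "T * 1 \<le> T * real_of_int k" using T by (intro mult_left_mono) auto
  then show ?thesis using k by simp
qed

end

theorem theorem2p2:
  fixes K1 K2 a1 a2 c T \<theta> :: real and m n :: nat
  assumes "K1 > 1" and "1 > K2" and "K2 > 0"
    and "a2 > a1" and "a1 > 0" and "c > 0"
    and "T = (a1 * (1 + K1 + K2) + (a2 - a1) * K2) /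
             (1 + (real m + 1) * K2 + real n * (1 + K1 + K2))"
    and "\<theta> = (a2 - a1) / T - real m"
    and "\<theta> \<in> {K2 / (K1 + K2 - 1) <..< 1}"
  shows "\<exists>\<mu>0 \<mu>1 \<mu>2.
           periodic_singular_solution K1 K2 a1 a2 c UNIV (sawtooth a1 c n T) \<mu>0 \<mu>1 \<mu>2 T"
proof -
  let ?N = "a1 * (1 + K1 + K2) + (a2 - a1) * K2"
  let ?D = "1 + (real m + 1) * K2 + real n * (1 + K1 + K2)"
  have D: "?D > 0" using assms(1,3) by (intro add_pos_nonneg) auto
  have N: "?N > 0" using assms(1,3,4,5) by (intro add_pos_pos mult_pos_pos) auto
  have T: "T > 0" unfolding assms(7) using N D by (rule divide_pos_pos)
  have period_eq: "T * ?D = ?N" using D by (subst assms(7)) simp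
  have diff: "a2 - a1 = (real m + \<theta>) * T" using assms(8) T by (simp add: field_simps)
  have "0 < K2 / (K1 + K2 - 1)" using assms(1,3) by simp
  then have pos: "0 < \<theta>" using assms(9) by auto
  have lower: "K2 < \<theta> * (K1 + K2 - 1)" using assms(1,3,9) by (simp add: field_simps)
  have "(1 + K1 + K2) * (a1 - real n * T) = T * (1 + K2 * (1 - \<theta>))"
    using period_eq unfolding diff by (simp add: algebra_simps)
  then interpret sawtooth_parameters K1 K2 a1 a2 c T \<theta> m n
    using assms(1,3,6,9) T lower diff pos by unfold_locales auto
  show ?thesis
    unfolding periodic_singular_solution_def
    using singular shift_periodic_T period_minimal by blast
qed

end
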